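(* Consider a sequence of integers $n$ and numbers $p=p(n)\in(0,1)$ such that $pn$ is an integer and $p(1-p)n\to\infty$. For each $n$ in the sequence let $f=f_n\colon\{0,1\}^n\to\{0,1\}$ be a Boolean function such that $\mathrm{Inf}[f]=o(\sqrt{p(1-p)n})$. Then $$\bigl|\mathbb E_{\mu_p}[f]-\mathbb E_{\nu_{pn}}[f]\bigr|=o(1).$$
   Context: For an integer $0\le k\le n$, $\nu_k$ is the uniform probability measure on the slice $\{x\in\{0,1\}^n:\sum_i x_i=k\}$. For $p\in(0,1)$, $\mu_p$ is the product measure on $\{0,1\}^n$ with $\mu_p(x)=p^{\sum_i x_i}(1-p)^{\sum_i(1-x_i)}$. The total influence of a Boolean function $f\colon\{0,1\}^n\to\{0,1\}$ (with respect to $p$) is $\mathrm{Inf}[f]=p(1-p)n\,\Pr[f(x)\ne f(y)]$, where $x\sim\mu_p$ and $y$ is obtained from $x$ by flipping one coordinate chosen uniformly at random among the $n$ coordinates. Asymptotic notation refers to the limit $p(1-p)n\to\infty$ along the sequence. *)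

theory Defs
  imports "HOL-Probability.Probability" "HOL-Library.Landau_Symbols"
begin

text \<open>
  Points of the cube are functions \<open>nat \<Rightarrow> bool\<close> (with True as 1 and False as 0)
  that are False outside \<open>{..<n}\<close>, so that each point has exactly one representative.
\<close>
definition cube :: "nat \<Rightarrow> (nat \<Rightarrow> bool) set" where
  "cube n = {x. \<forall>i\<ge>n. \<not> x i}"

definition slice :: "nat \<Rightarrow> nat \<Rightarrow> (nat \<Rightarrow> bool) set" where
  "slice n k = {x \<in> cube n. (\<Sum>i<n. of_bool (x i)) = k}"

definition nu :: "nat \<Rightarrow> nat \<Rightarrow> (nat \<Rightarrow> bool) pmf" where
  "nu n k = pmf_of_set (slice n k)"

definition mu :: "nat \<Rightarrow> real \<Rightarrow> (nat \<Rightarrow> bool) pmf" where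
  "mu n p = Pi_pmf {..<n} False (\<lambda>_. bernoulli_pmf p)"

definition flip :: "nat \<Rightarrow> (nat \<Rightarrow> bool) \<Rightarrow> (nat \<Rightarrow> bool)" where
  "flip i x = x(i := \<not> x i)"

definition expect :: "(nat \<Rightarrow> bool) pmf \<Rightarrow> ((nat \<Rightarrow> bool) \<Rightarrow> bool) \<Rightarrow> real" where
  "expect M f = measure_pmf.expectation M (\<lambda>x. of_bool (f x))"

text \<open>
  For \<open>n = 0\<close> there is no coordinate to draw and \<open>pmf_of_set {}\<close> is unspecified;
  the factor \<open>n\<close> makes the influence 0 in that case.
\<close>
definition total_influence :: "nat \<Rightarrow> real \<Rightarrow> ((nat \<Rightarrow> bool) \<Rightarrow> bool) \<Rightarrow> real" where
  "total_influence n p f = p * (1 - p) * real n *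
     measure_pmf.prob (pair_pmf (mu n p) (pmf_of_set {..<n})) {(x, i). f x \<noteq> f (flip i x)}"

lemma finite_cube: "finite (cube n)"
proof -
  have "cube n \<subseteq> (\<lambda>A i. i \<in> A) ` Pow {..<n}"
  proof
    fix x assume "x \<in> cube n"
    then have "{i. x i} \<in> Pow {..<n}" by (auto simp: cube_def not_le[symmetric])
    moreover have "x = (\<lambda>i. i \<in> {i. x i})" by simp
    ultimately show "x \<in> (\<lambda>A i. i \<in> A) ` Pow {..<n}" by blast
  qed
  then show ?thesis by (rule finite_subset) simp
qed

lemma slice_nonempty:
  assumes "k \<le> n"
  shows "slice n k \<noteq> {}"
proof -
  have "{..<n} \<inter> {i. i < k} = {..<k}" using assms by auto
  then have "(\<lambda>i. i < k) \<in> slice n k"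
    using assms by (auto simp: slice_def cube_def)
  then show ?thesis by blast
qed

lemma pmf_mu:
  assumes "0 \<le> p" "p \<le> 1" "x \<in> cube n"
  shows "pmf (mu n p) x =
    p ^ (\<Sum>i<n. of_bool (x i)) * (1 - p) ^ (\<Sum>i<n. 1 - of_bool (x i))"
proof -
  have "pmf (mu n p) x = (\<Prod>i<n. pmf (bernoulli_pmf p) (x i))"
    unfolding mu_def using assms(3) by (subst pmf_Pi') (auto simp: cube_def)
  also have "\<dots> = (\<Prod>i<n. p ^ of_bool (x i) * (1 - p) ^ (1 - of_bool (x i)))"
    using assms(1,2) by (intro prod.cong) auto
  finally show ?thesis by (simp only: prod.distrib power_sum)
qed

lemma set_pmf_mu: "set_pmf (mu n p) \<subseteq> cube n"
  unfolding mu_def using set_Pi_pmf_subset[of "{..<n}" False "\<lambda>_. bernoulli_pmf p"]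
  by (auto simp: cube_def)

end

theory Submission
  imports Defs
begin

text \<open>
  The proof is Stein's method for the binomial distribution, carried out on the edges of the cube,
  and it gives the explicit bound
  \<open>\<bar>\<mu>\<^sub>p(f) - \<nu>\<^sub>m(f)\<bar> \<le> (32/3) Inf[f] / \<sigma>\<close> whenever \<open>m = pn\<close> is an integer and
  \<open>\<sigma>\<^sup>2 = p(1-p)n \<ge> 1\<close>. The limit statement is immediate from it.

  Write \<open>X\<close> for the number of ones and \<open>Y = X - pn\<close>. Conditioning on the slice turns the difference
  into \<open>E[f \<cdot> (1 - 1[X = m] / P(X = m))]\<close> with \<open>E\<close> the mean under \<open>\<mu>\<^sub>p\<close>. Discrete integration by
  parts (\<open>integration_by_parts\<close>) says that for every \<open>\<phi>\<close>
  \<open>E[f \<cdot> (p(n-X)\<phi>(X) - (1-p)X\<phi>(X-1))] = \<Sum> p \<mu>\<^sub>p(x) \<phi>(X(x)) (f(x) - f(y))\<close>,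
  the sum being over upward edges \<open>x \<rightarrow> y\<close>; and the same sum with \<open>1[f(x) \<noteq> f(y)]\<close> in place of
  \<open>\<phi>(X(x))(f(x) - f(y))\<close> is exactly the total influence (\<open>total_influence_eq\<close>). So it suffices to
  find \<open>\<phi>\<close> with \<open>p(n-k)\<phi>(k) - (1-p)k\<phi>(k-1) = 1 - 1[k = m] / P(X = m)\<close> and
  \<open>\<bar>\<phi>\<bar> = O(1/\<sigma>)\<close>.

  The equation telescopes: its solution is \<open>\<phi>(k) = (P(X \<le> k) - 1[m \<le> k]) / (p(n-k)P(X = k))\<close>
  (\<open>stein_equation\<close>). The denominator equals both \<open>E[-Y; X \<le> k]\<close> and \<open>E[Y; X > k]\<close>, so
  \<open>1/\<bar>\<phi>(k)\<bar>\<close> is the mean of \<open>\<bar>Y\<bar>\<close> conditioned on the tail \<open>{X \<le> k}\<close> if \<open>k < m\<close> and on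
  \<open>{X > k}\<close> if \<open>k \<ge> m\<close>. Moving further into a tail only increases this conditional mean, hence it
  is at least \<open>E[max 0 Y] = E\<bar>Y\<bar>/2\<close> (\<open>tail_times_excess_le\<close>, \<open>cdf_diff_bound\<close>). Finally \<open>E\<bar>Y\<bar>\<close> is of
  order \<open>\<sigma>\<close> because the second and fourth moments of \<open>Y\<close> have their Gaussian order
  (\<open>mean_abs_dev_ge\<close>).
\<close>

section \<open>Weights and edges of the cube\<close>

definition weight :: "nat \<Rightarrow> (nat \<Rightarrow> bool) \<Rightarrow> nat" where
  "weight n x = (\<Sum>i<n. of_bool (x i))"

lemma weight_le: "weight n x \<le> n"
  using sum_bounded_above[of "{..<n}" "\<lambda>i. of_bool (x i)" "1::nat"] by (simp add: weight_def)

lemma sum_coordinates: "(\<Sum>i<n. of_bool (x i) :: real) = real (weight n x)"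
  by (simp add: weight_def)

lemma sum_zero_coordinates: "(\<Sum>i<n. of_bool (\<not> x i) :: real) = real n - real (weight n x)"
proof -
  have "(\<Sum>i<n. of_bool (\<not> x i) :: real) = (\<Sum>i<n. 1 - of_bool (x i))"
    by (intro sum.cong) auto
  then show ?thesis by (simp only: sum_subtractf sum_coordinates) simp
qed

lemma slice_iff: "x \<in> slice n k \<longleftrightarrow> x \<in> cube n \<and> weight n x = k"
  by (simp add: slice_def weight_def)

lemma flip_flip [simp]: "flip i (flip i x) = x"
  by (auto simp: flip_def)

lemma flip_same [simp]: "flip i x i \<longleftrightarrow> \<not> x i"
  by (simp add: flip_def)

lemma flip_in_cube [simp]: "i < n \<Longrightarrow> flip i x \<in> cube n \<longleftrightarrow> x \<in> cube n"
  by (auto simp: flip_def cube_def)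

lemma weight_flip:
  assumes "i < n" "\<not> x i"
  shows "weight n (flip i x) = Suc (weight n x)"
proof -
  have "(\<Sum>j\<in>{..<n} - {i}. of_bool (flip i x j)) = (\<Sum>j\<in>{..<n} - {i}. of_bool (x j) :: nat)"
    by (intro sum.cong) (auto simp: flip_def)
  then show ?thesis
    using assms by (simp add: weight_def sum.remove[of "{..<n}" i] del: sum_of_bool_eq)
qed

text \<open>
  The involution \<open>flip i\<close> swaps the two endpoints of each edge in direction \<open>i\<close>, so a sum over
  upper endpoints can be rewritten as a sum over lower ones.
\<close>

lemma edge_reversal:
  fixes F :: "nat \<Rightarrow> (nat \<Rightarrow> bool) \<Rightarrow> real"
  shows "(\<Sum>x\<in>cube n. \<Sum>i<n. of_bool (x i) * F i x)
       = (\<Sum>x\<in>cube n. \<Sum>i<n. of_bool (\<not> x i) * F i (flip i x))"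
proof -
  have "(\<Sum>x\<in>cube n. of_bool (x i) * F i x)
      = (\<Sum>x\<in>cube n. of_bool (\<not> x i) * F i (flip i x))" if "i < n" for i
    by (rule sum.reindex_bij_witness[of _ "flip i" "flip i"]) (use that in auto)
  then show ?thesis
    by (subst (1 2) sum.swap) simp
qed

section \<open>The biased measure and integration by parts\<close>

locale biased_cube =
  fixes n :: nat and p :: real
  assumes p_pos: "0 < p" and p_less_1: "p < 1"
begin

abbreviation w :: "(nat \<Rightarrow> bool) \<Rightarrow> real" where "w \<equiv> pmf (mu n p)"

definition mean :: "((nat \<Rightarrow> bool) \<Rightarrow> real) \<Rightarrow> real" where
  "mean h = (\<Sum>x\<in>cube n. w x * h x)"

text \<open>
  Since \<open>p \<mu>(x) = (1 - p) \<mu>(y)\<close> for an upward edge \<open>x \<rightarrow> y\<close>, the factor \<open>p \<mu>(x)\<close> is a weight of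
  the edge that can be read off from either end. A pair \<open>(i, x)\<close> with \<open>x i\<close> false stands for the
  edge \<open>x \<rightarrow> flip i x\<close>.
\<close>

definition up_edge_sum :: "(nat \<Rightarrow> (nat \<Rightarrow> bool) \<Rightarrow> real) \<Rightarrow> real" where
  "up_edge_sum F = (\<Sum>x\<in>cube n. \<Sum>i<n. of_bool (\<not> x i) * (p * w x * F i x))"

lemma w_eq: "x \<in> cube n \<Longrightarrow> w x = p ^ weight n x * (1 - p) ^ (n - weight n x)"
proof -
  assume "x \<in> cube n"
  moreover have "(\<Sum>i<n. 1 - of_bool (x i)) = n - weight n x"
    unfolding weight_def by (subst sum_subtractf_nat) auto
  ultimately show ?thesis
    using pmf_mu[of p x n] p_pos p_less_1 by (simp add: weight_def)
qed

lemma w_pos: "x \<in> cube n \<Longrightarrow> 0 < w x"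
  using p_pos p_less_1 by (simp add: w_eq)

lemma w_flip:
  assumes "x \<in> cube n" "i < n" "\<not> x i"
  shows "(1 - p) * w (flip i x) = p * w x"
proof -
  have "Suc (weight n x) \<le> n"
    using weight_flip[of i n x] weight_le[of n "flip i x"] assms by simp
  then have "n - weight n x = Suc (n - Suc (weight n x))" by simp
  then show ?thesis using assms by (simp add: w_eq weight_flip)
qed

lemma mean_add: "mean (\<lambda>x. g x + h x) = mean g + mean h"
  by (simp add: mean_def distrib_left sum.distrib)

lemma mean_diff: "mean (\<lambda>x. g x - h x) = mean g - mean h"
  by (simp add: mean_def right_diff_distrib sum_subtractf)

lemma mean_cmult: "mean (\<lambda>x. c * h x) = c * mean h"
  by (simp add: mean_def sum_distrib_left mult_ac)

lemma mean_cong: "(\<And>x. x \<in> cube n \<Longrightarrow> g x = h x) \<Longrightarrow> mean g = mean h"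
  by (simp add: mean_def)

lemma mean_mono: "(\<And>x. x \<in> cube n \<Longrightarrow> g x \<le> h x) \<Longrightarrow> mean g \<le> mean h"
  unfolding mean_def by (intro sum_mono mult_left_mono) auto

lemma expectation_eq_mean: "measure_pmf.expectation (mu n p) h = mean h"
  unfolding mean_def using set_pmf_mu[of n p] finite_cube[of n]
  by (subst integral_measure_pmf[of "cube n"]) (auto simp: mult.commute)

lemma mean_const: "mean (\<lambda>x. c) = c"
  by (simp flip: expectation_eq_mean)

text \<open>
  Split the difference \<open>f x - f (flip i x)\<close> and charge each half of the edge to its own endpoint:
  a point of weight \<open>k\<close> has \<open>n - k\<close> upward edges, each seen with \<open>\<phi> k\<close>, and \<open>k\<close> downward ones, each
  seen from below with \<open>\<phi> (k - 1)\<close>. At \<open>k = 0\<close> the factor \<open>k\<close> hides the truncated subtraction.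
\<close>

lemma integration_by_parts:
  "up_edge_sum (\<lambda>i x. \<phi> (weight n x) * (f x - f (flip i x)))
   = mean (\<lambda>x. f x * (p * (real n - real (weight n x)) * \<phi> (weight n x)
                      - (1 - p) * real (weight n x) * \<phi> (weight n x - 1)))"
proof -
  let ?F = "\<lambda>i y. (1 - p) * w y * \<phi> (weight n y - 1) * f y"
  have "up_edge_sum (\<lambda>i x. \<phi> (weight n x) * (f x - f (flip i x)))
      = (\<Sum>x\<in>cube n. \<Sum>i<n. of_bool (\<not> x i) * (p * w x * \<phi> (weight n x) * f x)
            - of_bool (\<not> x i) * ?F i (flip i x))"
    unfolding up_edge_sum_def
    by (intro sum.cong refl) (auto simp: right_diff_distrib weight_flip w_flip)
  also have "\<dots> = (\<Sum>x\<in>cube n. \<Sum>i<n. of_bool (\<not> x i) * (p * w x * \<phi> (weight n x) * f x))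
            - (\<Sum>x\<in>cube n. \<Sum>i<n. of_bool (x i) * ?F i x)"
    by (simp only: sum_subtractf edge_reversal)
  also have "\<dots> = mean (\<lambda>x. f x * (p * (real n - real (weight n x)) * \<phi> (weight n x)
                      - (1 - p) * real (weight n x) * \<phi> (weight n x - 1)))"
    unfolding mean_def sum_subtractf[symmetric] sum_distrib_right[symmetric]
      sum_zero_coordinates
    unfolding sum_coordinates
    by (intro sum.cong refl) (simp add: algebra_simps)
  finally show ?thesis .
qed

text \<open>
  Both endpoints of an edge detect the same change of \<open>f\<close>, and their masses, multiplied by
  \<open>p(1 - p)\<close>, add up to the edge weight: \<open>p(1-p)\<mu>(x) + p(1-p)\<mu>(y) = p(1-p)\<mu>(x) + p\<^sup>2\<mu>(x) = p\<mu>(x)\<close>.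
\<close>

lemma total_influence_eq:
  "total_influence n p f = up_edge_sum (\<lambda>i x. of_bool (f x \<noteq> f (flip i x)))"
proof (cases "n = 0")
  case True
  then show ?thesis unfolding total_influence_def up_edge_sum_def by simp
next
  case False
  let ?d = "\<lambda>i x. of_bool (f x \<noteq> f (flip i x)) :: real"
  let ?S = "\<Sum>x\<in>cube n. \<Sum>i<n. w x * ?d i x"
  have "indicator {(x, i). f x \<noteq> f (flip i x)} = (\<lambda>(x, i). ?d i x)"
    by (auto simp: fun_eq_iff indicator_def)
  then have "measure_pmf.prob (pair_pmf (mu n p) (pmf_of_set {..<n})) {(x, i). f x \<noteq> f (flip i x)}
      = measure_pmf.expectation (pair_pmf (mu n p) (pmf_of_set {..<n})) (\<lambda>(x, i). ?d i x)"
    using Bochner_Integration.integral_indicator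
      [of "measure_pmf (pair_pmf (mu n p) (pmf_of_set {..<n}))" "{(x, i). f x \<noteq> f (flip i x)}"]
    by (simp del: Bochner_Integration.integral_indicator)
  also have "\<dots> = (\<Sum>(x, i)\<in>cube n \<times> {..<n}. (w x * (1 / real n)) * ?d i x)"
    using set_pmf_mu[of n p] finite_cube[of n] False
    by (subst integral_measure_pmf[of "cube n \<times> {..<n}"])
       (auto simp: pmf_pair lessThan_empty_iff intro!: sum.cong)
  also have "\<dots> = ?S / real n"
    by (simp add: sum.cartesian_product[symmetric] sum_divide_distrib
        del: sum_mult_of_bool_eq sum_of_bool_mult_eq)
  finally have "total_influence n p f = p * (1 - p) * ?S"
    using False by (simp add: total_influence_def)
  also have "?S = (\<Sum>x\<in>cube n. \<Sum>i<n. of_bool (x i) * (w x * ?d i x))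
               + (\<Sum>x\<in>cube n. \<Sum>i<n. of_bool (\<not> x i) * (w x * ?d i x))"
    unfolding sum.distrib[symmetric] by (intro sum.cong refl) auto
  also have "\<dots> = (\<Sum>x\<in>cube n. \<Sum>i<n. of_bool (\<not> x i) * (w (flip i x) * ?d i (flip i x))
                 + of_bool (\<not> x i) * (w x * ?d i x))"
    by (simp only: edge_reversal sum.distrib)
  also have "p * (1 - p) * \<dots> = up_edge_sum ?d"
    unfolding up_edge_sum_def sum_distrib_left
  proof (intro sum.cong refl)
    fix x i assume *: "x \<in> cube n" "i \<in> {..<n}"
    show "p * (1 - p) * (of_bool (\<not> x i) * (w (flip i x) * ?d i (flip i x))
                 + of_bool (\<not> x i) * (w x * ?d i x))
         = of_bool (\<not> x i) * (p * w x * ?d i x)"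
    proof (cases "x i")
      case False
      have "p * (1 - p) * (w (flip i x) + w x) = p * ((1 - p) * w (flip i x)) + p * (1 - p) * w x"
        by (simp add: algebra_simps)
      also have "\<dots> = p * (p * w x) + p * (1 - p) * w x"
        using w_flip[of x i] False * by simp
      also have "\<dots> = p * w x"
        by (simp add: algebra_simps)
      finally show ?thesis using False by (cases "f x = f (flip i x)") auto
    qed auto
  qed
  finally show ?thesis .
qed

lemma weighted_difference_le_influence:
  fixes f :: "(nat \<Rightarrow> bool) \<Rightarrow> bool"
  assumes "\<And>k. k < n \<Longrightarrow> \<bar>\<phi> k\<bar> \<le> C"
  shows "\<bar>up_edge_sum (\<lambda>i x. \<phi> (weight n x) * (of_bool (f x) - of_bool (f (flip i x))))\<bar>
         \<le> C * total_influence n p f"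
  unfolding total_influence_eq up_edge_sum_def sum_distrib_left
proof (intro order.trans[OF sum_abs] sum_mono)
  fix x i assume *: "x \<in> cube n" "i \<in> {..<n}"
  have "\<bar>\<phi> (weight n x)\<bar> \<le> C" if "\<not> x i"
    using assms[of "weight n x"] weight_flip[of i n x] weight_le[of n "flip i x"] that * by simp
  moreover have pos: "0 < p * w x" using p_pos w_pos * by simp
  ultimately have "p * w x * \<bar>\<phi> (weight n x)\<bar> \<le> p * w x * C" if "\<not> x i"
    using that by (intro mult_left_mono) auto
  then show "\<bar>of_bool (\<not> x i) * (p * w x *
      (\<phi> (weight n x) * (of_bool (f x) - of_bool (f (flip i x)))))\<bar>
    \<le> C * (of_bool (\<not> x i) * (p * w x * of_bool (f x \<noteq> f (flip i x))))"
    using pos p_pos by (auto simp: abs_mult mult_ac)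
qed

text \<open>
  Integration by parts for the constant function \<open>1\<close>, where the edge sum vanishes.
\<close>

lemma exchange_identity:
  "mean (\<lambda>x. p * (real n - real (weight n x)) * g (Suc (weight n x)))
   = mean (\<lambda>x. (1 - p) * real (weight n x) * g (weight n x))"
proof -
  have "0 = mean (\<lambda>x. p * (real n - real (weight n x)) * g (Suc (weight n x))
                      - (1 - p) * real (weight n x) * g (Suc (weight n x - 1)))"
    using integration_by_parts[of "\<lambda>k. g (Suc k)" "\<lambda>_. 1"] by (simp add: up_edge_sum_def)
  also have "\<dots> = mean (\<lambda>x. p * (real n - real (weight n x)) * g (Suc (weight n x))
                      - (1 - p) * real (weight n x) * g (weight n x))"
  proof (rule mean_cong)
    fix x
    show "p * (real n - real (weight n x)) * g (Suc (weight n x))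
            - (1 - p) * real (weight n x) * g (Suc (weight n x - 1))
        = p * (real n - real (weight n x)) * g (Suc (weight n x))
            - (1 - p) * real (weight n x) * g (weight n x)"
      by (cases "weight n x") auto
  qed
  finally show ?thesis by (simp add: mean_diff)
qed

text \<open>
  Taking powers for \<open>g\<close> gives the moments of the weight, taking indicators of \<open>{..k}\<close> its truncated
  means, in both cases without reference to binomial coefficients.
\<close>

lemma stein_identity:
  "mean (\<lambda>x. (real (weight n x) - p * real n) * g (weight n x))
   = mean (\<lambda>x. p * (real n - real (weight n x)) * (g (Suc (weight n x)) - g (weight n x)))"
proof -
  have "mean (\<lambda>x. (real (weight n x) - p * real n) * g (weight n x))
      = mean (\<lambda>x. (1 - p) * real (weight n x) * g (weight n x)
                  - p * (real n - real (weight n x)) * g (weight n x))"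
    by (intro mean_cong) (simp add: algebra_simps)
  also have "\<dots> = mean (\<lambda>x. p * (real n - real (weight n x)) * g (Suc (weight n x))
                  - p * (real n - real (weight n x)) * g (weight n x))"
    by (simp only: mean_diff exchange_identity)
  finally show ?thesis by (simp add: right_diff_distrib)
qed

section \<open>Moments and the mean absolute deviation\<close>

definition dev :: "(nat \<Rightarrow> bool) \<Rightarrow> real" where
  "dev x = real (weight n x) - p * real n"

definition variance :: real where
  "variance = p * (1 - p) * real n"

text \<open>
  Each use with \<open>h\<close> a power of degree \<open>d\<close> expresses the moment of order \<open>d + 1\<close> by moments of order at
  most \<open>d\<close>: the increment of \<open>h\<close> loses one degree and \<open>variance - p * dev\<close> gains one.
\<close>

lemma mean_dev_mult:
  "mean (\<lambda>x. dev x * h (dev x)) = mean (\<lambda>x. (variance - p * dev x) * (h (dev x + 1) - h (dev x)))"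
proof -
  have "mean (\<lambda>x. dev x * h (dev x))
      = mean (\<lambda>x. p * (real n - real (weight n x)) * (h (dev x + 1) - h (dev x)))"
    using stein_identity[of "\<lambda>k. h (real k - p * real n)"]
    by (simp add: dev_def algebra_simps)
  also have "(\<lambda>x. p * (real n - real (weight n x))) = (\<lambda>x. variance - p * dev x)"
    by (simp add: dev_def variance_def algebra_simps)
  then have "mean (\<lambda>x. p * (real n - real (weight n x)) * (h (dev x + 1) - h (dev x)))
      = mean (\<lambda>x. (variance - p * dev x) * (h (dev x + 1) - h (dev x)))"
    by metis
  finally show ?thesis .
qed

lemma mean_dev: "mean dev = 0"
  using mean_dev_mult[of "\<lambda>_. 1"] by (simp add: mean_const)

lemma mean_dev_power2: "mean (\<lambda>x. dev x ^ 2) = variance"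
proof -
  have "mean (\<lambda>x. dev x ^ 2) = mean (\<lambda>x. variance - p * dev x)"
    using mean_dev_mult[of "\<lambda>y. y"] by (simp add: power2_eq_square)
  then show ?thesis by (simp add: mean_diff mean_cmult mean_const mean_dev)
qed

lemma mean_dev_power3: "mean (\<lambda>x. dev x ^ 3) = variance * (1 - 2 * p)"
proof -
  have "mean (\<lambda>x. dev x ^ 3)
      = mean (\<lambda>x. variance + ((2 * variance - p) * dev x - 2 * p * dev x ^ 2))"
    using mean_dev_mult[of "\<lambda>y. y ^ 2"] by (simp add: power2_eq_square power3_eq_cube algebra_simps)
  also have "\<dots> = variance - 2 * p * variance"
    by (simp add: mean_add mean_diff mean_cmult mean_const mean_dev mean_dev_power2)
  finally show ?thesis by (simp add: algebra_simps)
qed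

lemma mean_dev_power4:
  "mean (\<lambda>x. dev x ^ 4) = 3 * variance ^ 2 + variance * (1 - 6 * p * (1 - p))"
proof -
  have "mean (\<lambda>x. dev x ^ 4) = mean (\<lambda>x. dev x * dev x ^ 3)"
    by (intro mean_cong) (simp add: eval_nat_numeral)
  also have "\<dots> = mean (\<lambda>x. (variance - p * dev x) * ((dev x + 1) ^ 3 - dev x ^ 3))"
    by (rule mean_dev_mult)
  also have "\<dots> = mean (\<lambda>x. variance + ((3 * variance - p) * dev x
      + (3 * (variance - p) * dev x ^ 2 - 3 * p * dev x ^ 3)))"
    by (intro mean_cong) (simp add: power2_eq_square power3_eq_cube algebra_simps)
  also have "\<dots> = variance + 3 * (variance - p) * variance - 3 * p * (variance * (1 - 2 * p))"
    by (simp add: mean_add mean_diff mean_cmult mean_const mean_dev mean_dev_power2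
        mean_dev_power3)
  finally show ?thesis by (simp add: power2_eq_square algebra_simps)
qed

text \<open>
  A fourth moment of order \<open>variance ^ 2\<close> prevents the variance from coming from rare large values,
  so the first absolute moment has to be of order \<open>sqrt variance\<close>. Concretely,
  \<open>u \<ge> u\<^sup>2 - u\<^sup>4\<close> is applied to \<open>u = \<bar>dev x\<bar> / t\<close>; the scale \<open>t = 4 * sqrt variance\<close> makes the quartic
  loss, at most \<open>4 / 64\<close> in units of \<open>sqrt variance\<close>, smaller than the quadratic gain, \<open>1 / 4\<close>.
\<close>

lemma mean_abs_dev_ge:
  assumes "1 \<le> variance"
  shows "3 / 16 * sqrt variance \<le> mean (\<lambda>x. \<bar>dev x\<bar>)"
proof -
  define t where "t = 4 * sqrt variance"
  have t: "0 < t" "t ^ 2 = 16 * variance"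
    using assms by (auto simp: t_def power_mult_distrib)
  have elementary: "(1 / t) * y ^ 2 - (1 / t ^ 3) * y ^ 4 \<le> \<bar>y\<bar>" for y :: real
  proof -
    define u where "u = \<bar>y\<bar> / t"
    have u: "0 \<le> u" "\<bar>y\<bar> = t * u" using t by (auto simp: u_def)
    have y: "y ^ 2 = t ^ 2 * u ^ 2" "y ^ 4 = t ^ 4 * u ^ 4"
      by (simp_all flip: u(2) power_mult_distrib add: power_even_abs)
    have "u ^ 2 - u ^ 4 \<le> u"
    proof (cases "u \<le> 1")
      case True
      then have "u ^ 2 \<le> u" using u by (simp add: power2_eq_square mult_left_le)
      moreover have "0 \<le> u ^ 4" by simp
      ultimately show ?thesis by linarith
    next
      case False
      then have "u ^ 2 \<le> u ^ 4" by (intro power_increasing) auto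
      then show ?thesis using u by linarith
    qed
    then have "t * (u ^ 2 - u ^ 4) \<le> t * u" using t by (intro mult_left_mono) auto
    moreover have "(1 / t) * y ^ 2 - (1 / t ^ 3) * y ^ 4 = t * (u ^ 2 - u ^ 4)"
      unfolding y using t(1) by (simp add: field_simps eval_nat_numeral)
    ultimately show ?thesis using u by simp
  qed
  have "variance * (1 - 6 * p * (1 - p)) \<le> variance * variance"
  proof (rule mult_left_mono)
    have "0 \<le> p * (1 - p)" using p_pos p_less_1 by simp
    then show "1 - 6 * p * (1 - p) \<le> variance" using assms by simp
  qed (use assms in simp)
  then have fourth: "mean (\<lambda>x. dev x ^ 4) \<le> 4 * variance ^ 2"
    by (simp add: mean_dev_power4 power2_eq_square)
  have "3 / 16 * sqrt variance = (1 / t) * variance - (1 / t ^ 3) * (4 * variance ^ 2)"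
  proof -
    have v: "variance = t ^ 2 / 16" and s: "sqrt variance = t / 4"
      using t(2) by (simp_all add: t_def)
    show ?thesis
      unfolding s unfolding v using t(1) by (simp add: field_simps eval_nat_numeral)
  qed
  also have "\<dots> \<le> (1 / t) * mean (\<lambda>x. dev x ^ 2) - (1 / t ^ 3) * mean (\<lambda>x. dev x ^ 4)"
    unfolding mean_dev_power2 using fourth t(1) by (intro diff_left_mono mult_left_mono) auto
  also have "\<dots> = mean (\<lambda>x. (1 / t) * dev x ^ 2 - (1 / t ^ 3) * dev x ^ 4)"
    by (simp only: mean_diff mean_cmult)
  also have "\<dots> \<le> mean (\<lambda>x. \<bar>dev x\<bar>)"
    by (intro mean_mono elementary)
  finally show ?thesis .
qed

text \<open>
  As \<open>dev\<close> has mean zero, the mean excess over \<open>pn\<close> is also the mean shortfall below it, which lets one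
  constant serve both tails.
\<close>
definition mean_excess :: real where
  "mean_excess = mean (\<lambda>x. max 0 (dev x))"

lemma mean_excess_eq_shortfall: "mean_excess = mean (\<lambda>x. max 0 (- dev x))"
proof -
  have "mean_excess - mean (\<lambda>x. max 0 (- dev x)) = mean dev"
    unfolding mean_excess_def mean_diff[symmetric] by (intro mean_cong) auto
  then show ?thesis by (simp add: mean_dev)
qed

lemma mean_excess_eq_abs: "mean_excess = mean (\<lambda>x. \<bar>dev x\<bar>) / 2"
proof -
  have "mean_excess + mean (\<lambda>x. max 0 (- dev x)) = mean (\<lambda>x. \<bar>dev x\<bar>)"
    unfolding mean_excess_def mean_add[symmetric] by (intro mean_cong) auto
  then show ?thesis by (simp flip: mean_excess_eq_shortfall)
qed

text \<open>
  In conditional form: the mean of \<open>Z\<close> given \<open>Z \<ge> s\<close> is at least the mean of \<open>max 0 Z\<close>. With \<open>P\<close> the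
  probability of the tail and \<open>A\<close> the truncated mean, the excess is at most \<open>s(1 - P) + A\<close>, and
  \<open>sP \<le> A\<close>.
\<close>

lemma tail_times_excess_le:
  assumes "0 \<le> s"
  shows "mean (\<lambda>x. of_bool (s \<le> Z x)) * mean (\<lambda>x. max 0 (Z x))
         \<le> mean (\<lambda>x. Z x * of_bool (s \<le> Z x))"
proof -
  define P where "P = mean (\<lambda>x. of_bool (s \<le> Z x))"
  define A where "A = mean (\<lambda>x. Z x * of_bool (s \<le> Z x))"
  have "0 \<le> P" "P \<le> 1"
    using mean_mono[of "\<lambda>_. 0" "\<lambda>x. of_bool (s \<le> Z x)"]
      mean_mono[of "\<lambda>x. of_bool (s \<le> Z x)" "\<lambda>_. 1"]
    by (auto simp: P_def mean_const)
  have "mean (\<lambda>x. max 0 (Z x)) \<le> mean (\<lambda>x. s * (1 - of_bool (s \<le> Z x)) + Z x * of_bool (s \<le> Z x))"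
    using assms by (intro mean_mono) auto
  also have "\<dots> = s * (1 - P) + A"
    by (simp add: mean_add mean_cmult mean_diff mean_const P_def A_def)
  finally have "P * mean (\<lambda>x. max 0 (Z x)) \<le> P * (s * (1 - P) + A)"
    using \<open>0 \<le> P\<close> by (rule mult_left_mono)
  also have "\<dots> = (s * P) * (1 - P) + A * P" by (simp add: algebra_simps)
  also have "s * P \<le> A"
    unfolding P_def A_def mean_cmult[symmetric] by (intro mean_mono) auto
  then have "(s * P) * (1 - P) + A * P \<le> A * (1 - P) + A * P"
    using \<open>P \<le> 1\<close> by (intro add_right_mono mult_right_mono) auto
  finally show ?thesis by (simp add: P_def A_def algebra_simps)
qed

section \<open>The Stein equation\<close>

definition level :: "nat \<Rightarrow> real" where
  "level k = mean (\<lambda>x. of_bool (weight n x = k))"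

lemma level_pos:
  assumes "k \<le> n"
  shows "0 < level k"
proof -
  obtain x where x: "x \<in> cube n" "weight n x = k"
    using slice_nonempty[OF assms] unfolding ex_in_conv[symmetric] slice_iff by blast
  show ?thesis
    unfolding level_def mean_def
    by (rule sum_pos2[OF finite_cube x(1)]) (use x w_pos in auto)
qed

lemma level_balance:
  "p * (real n - real k) * level k = (1 - p) * real (Suc k) * level (Suc k)"
proof -
  have "p * (real n - real k) * level k
      = mean (\<lambda>x. p * (real n - real (weight n x)) * of_bool (Suc (weight n x) = Suc k))"
    unfolding level_def mean_cmult[symmetric] by (intro mean_cong) auto
  also have "\<dots> = mean (\<lambda>x. (1 - p) * real (weight n x) * of_bool (weight n x = Suc k))"
    by (rule exchange_identity)
  also have "\<dots> = (1 - p) * real (Suc k) * level (Suc k)"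
    unfolding level_def mean_cmult[symmetric] by (intro mean_cong) auto
  finally show ?thesis .
qed

text \<open>
  De Moivre's formula for the truncated mean of the binomial distribution; it turns the denominator
  of the Stein solution into a conditional mean.
\<close>

lemma mean_dev_below:
  "mean (\<lambda>x. dev x * of_bool (weight n x \<le> k)) = - (p * (real n - real k) * level k)"
proof -
  have "mean (\<lambda>x. dev x * of_bool (weight n x \<le> k))
      = mean (\<lambda>x. p * (real n - real (weight n x)) *
               (of_bool (Suc (weight n x) \<le> k) - of_bool (weight n x \<le> k)))"
    unfolding dev_def by (rule stein_identity)
  also have "\<dots> = mean (\<lambda>x. - (p * (real n - real k)) * of_bool (weight n x = k))"
    by (intro mean_cong) (auto simp: not_less_eq_eq)
  also have "\<dots> = - (p * (real n - real k) * level k)"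
    unfolding mean_cmult level_def by simp
  finally show ?thesis .
qed

text \<open>
  The difference of the distribution functions of the weight under \<open>\<mu>\<^sub>p\<close> and under \<open>\<nu>\<^sub>m\<close>.
\<close>
definition cdf_diff :: "nat \<Rightarrow> nat \<Rightarrow> real" where
  "cdf_diff m k = mean (\<lambda>x. of_bool (weight n x \<le> k)) - of_bool (m \<le> k)"

text \<open>
  For \<open>k < m\<close> the left side involves the lower tail \<open>{X \<le> k}\<close>, for \<open>k \<ge> m\<close> the upper tail
  \<open>{X > k}\<close>. In both cases the right side is the mean of \<open>\<bar>dev\<bar>\<close> truncated to that tail, which is
  of the form \<open>{Z \<ge> s}\<close> with \<open>s \<ge> 0\<close>, for \<open>Z = - dev\<close> and \<open>Z = dev\<close> respectively.
\<close>

lemma cdf_diff_bound: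
  assumes m: "real m = p * real n"
  shows "\<bar>cdf_diff m k\<bar> * mean_excess \<le> p * (real n - real k) * level k"
proof (cases "k < m")
  case True
  have iff: "real m - real k \<le> - dev x \<longleftrightarrow> weight n x \<le> k" for x
    by (auto simp: dev_def simp flip: m)
  have "cdf_diff m k = mean (\<lambda>x. of_bool (weight n x \<le> k))"
    using True by (simp add: cdf_diff_def)
  moreover have "0 \<le> mean (\<lambda>x. of_bool (weight n x \<le> k))"
    using mean_mono[of "\<lambda>_. 0" "\<lambda>x. of_bool (weight n x \<le> k)"] by (simp add: mean_const)
  moreover have "mean (\<lambda>x. of_bool (weight n x \<le> k)) * mean_excess
      \<le> mean (\<lambda>x. (-1) * (dev x * of_bool (weight n x \<le> k)))"
    using tail_times_excess_le[of "real m - real k" "\<lambda>x. - dev x"] True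
    by (simp add: iff mean_excess_eq_shortfall)
  ultimately show ?thesis
    unfolding mean_cmult mean_dev_below by simp
next
  case False
  have iff: "real (Suc k) - real m \<le> dev x \<longleftrightarrow> \<not> weight n x \<le> k" for x
    by (auto simp: dev_def simp flip: m)
  have "mean (\<lambda>x. of_bool (\<not> weight n x \<le> k)) = mean (\<lambda>x. 1 - of_bool (weight n x \<le> k))"
    by (intro mean_cong) auto
  then have "cdf_diff m k = - mean (\<lambda>x. of_bool (\<not> weight n x \<le> k))"
    using False by (simp add: cdf_diff_def mean_diff mean_const)
  moreover have "0 \<le> mean (\<lambda>x. of_bool (\<not> weight n x \<le> k))"
    using mean_mono[of "\<lambda>_. 0" "\<lambda>x. of_bool (\<not> weight n x \<le> k)"] by (simp add: mean_const)
  moreover have "mean (\<lambda>x. of_bool (\<not> weight n x \<le> k)) * mean_excess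
      \<le> mean (\<lambda>x. dev x * of_bool (\<not> weight n x \<le> k))"
    using tail_times_excess_le[of "real (Suc k) - real m" dev] False
    unfolding iff mean_excess_def by simp
  moreover have "mean (\<lambda>x. dev x * of_bool (\<not> weight n x \<le> k))
      = mean (\<lambda>x. dev x - dev x * of_bool (weight n x \<le> k))"
    by (intro mean_cong) auto
  ultimately show ?thesis
    by (simp add: mean_diff mean_dev mean_dev_below)
qed

lemma cdf_diff_Suc:
  "cdf_diff m (Suc k) - cdf_diff m k = level (Suc k) - of_bool (Suc k = m)"
proof -
  have "mean (\<lambda>x. of_bool (weight n x \<le> Suc k))
      = mean (\<lambda>x. of_bool (weight n x \<le> k) + of_bool (weight n x = Suc k))"
    by (intro mean_cong) auto
  then show ?thesis by (auto simp: cdf_diff_def level_def mean_add)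
qed

text \<open>
  At \<open>k = n\<close> the denominator is zero and the value is the default \<open>0\<close>; for \<open>m \<le> n\<close> the numerator is zero too,
  and the Stein equation only sees the product with \<open>n - k = 0\<close>.
\<close>
definition stein_solution :: "nat \<Rightarrow> nat \<Rightarrow> real" where
  "stein_solution m k = cdf_diff m k / (p * (real n - real k) * level k)"

text \<open>
  By the definition and by \<open>level_balance\<close>, the two terms on the left are
  \<open>cdf_diff m k / level k\<close> and \<open>cdf_diff m (k - 1) / level k\<close>, so their difference is the difference
  of the point masses at \<open>k\<close>, divided by \<open>level k\<close>.
\<close>

lemma stein_equation:
  assumes "k \<le> n" "m \<le> n"
  shows "p * (real n - real k) * stein_solution m k
           - (1 - p) * real k * stein_solution m (k - 1)
         = 1 - of_bool (k = m) / level m"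
proof -
  have "mean (\<lambda>x. of_bool (weight n x \<le> n)) = 1"
    by (simp add: weight_le mean_const)
  then have "cdf_diff m n = 0"
    using assms by (simp add: cdf_diff_def)
  then have first: "p * (real n - real k) * stein_solution m k = cdf_diff m k / level k"
    using assms p_pos by (cases "k = n") (auto simp: stein_solution_def)
  show ?thesis
  proof (cases k)
    case 0
    have "cdf_diff m 0 = level 0 - of_bool (0 = m)"
      by (auto simp: cdf_diff_def level_def)
    then show ?thesis
      using first 0 level_pos[of 0] by (cases "m = 0") (auto simp: diff_divide_distrib)
  next
    case (Suc j)
    have "stein_solution m j = cdf_diff m j / ((1 - p) * real k * level k)"
      by (simp add: stein_solution_def level_balance Suc del: of_nat_Suc)
    then have "(1 - p) * real k * stein_solution m (k - 1) = cdf_diff m j / level k"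
      using Suc p_less_1 by simp
    then have "p * (real n - real k) * stein_solution m k
           - (1 - p) * real k * stein_solution m (k - 1)
         = (level k - of_bool (k = m)) / level k"
      using cdf_diff_Suc[of m j] first by (simp add: Suc flip: diff_divide_distrib)
    then show ?thesis
      using level_pos[OF assms(1)] by (auto simp: diff_divide_distrib)
  qed
qed

section \<open>Comparing the cube with its middle slice\<close>

text \<open>
  The mass \<open>p\<^sup>m(1-p)\<^sup>n\<^sup>-\<^sup>m\<close> is constant on the slice, so \<open>\<nu>\<^sub>m\<close> is \<open>\<mu>\<^sub>p\<close> conditioned on weight \<open>m\<close>.
\<close>

lemma expect_nu_eq:
  assumes "m \<le> n"
  shows "expect (nu n m) f = mean (\<lambda>x. of_bool (f x) * of_bool (weight n x = m)) / level m"
proof -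
  define q where "q = p ^ m * (1 - p) ^ (n - m)"
  have q: "0 < q" using p_pos p_less_1 by (simp add: q_def)
  have fin: "finite (slice n m)"
    by (rule finite_subset[OF _ finite_cube[of n]]) (auto simp: slice_def)
  have on_slice: "mean (\<lambda>x. h x * of_bool (weight n x = m)) = q * (\<Sum>x\<in>slice n m. h x)" for h
  proof -
    have "mean (\<lambda>x. h x * of_bool (weight n x = m)) = (\<Sum>x\<in>slice n m. w x * h x)"
      unfolding mean_def using finite_cube[of n]
      by (intro sum.mono_neutral_cong_right) (auto simp: slice_iff)
    also have "\<dots> = (\<Sum>x\<in>slice n m. q * h x)"
      by (intro sum.cong) (auto simp: slice_iff w_eq q_def)
    finally show ?thesis by (simp add: sum_distrib_left)
  qed
  have "level m = q * real (card (slice n m))"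
    using on_slice[of "\<lambda>_. 1"] by (simp add: level_def)
  then show ?thesis
    using q slice_nonempty[OF assms] fin
    by (simp add: on_slice expect_def nu_def integral_pmf_of_set del: sum_of_bool_eq)
qed

theorem expect_mu_nu_bound:
  assumes m: "real m = p * real n" and v: "1 \<le> variance"
  shows "\<bar>expect (mu n p) f - expect (nu n m) f\<bar> \<le> 32 / 3 * (total_influence n p f / sqrt variance)"
proof -
  have "real m \<le> real n"
    unfolding m using p_less_1 by (intro mult_left_le_one_le) (use p_pos in auto)
  then have mn: "m \<le> n" by simp
  have excess: "3 / 32 * sqrt variance \<le> mean_excess"
    using mean_abs_dev_ge[OF v] by (simp add: mean_excess_eq_abs)
  have bound: "\<bar>stein_solution m k\<bar> \<le> 32 / 3 / sqrt variance" if "k < n" for k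
  proof -
    have W: "0 < p * (real n - real k) * level k"
      using that p_pos level_pos[of k] by simp
    have "\<bar>cdf_diff m k\<bar> * (3 / 32 * sqrt variance) \<le> \<bar>cdf_diff m k\<bar> * mean_excess"
      using excess by (intro mult_left_mono) auto
    also have "\<dots> \<le> p * (real n - real k) * level k"
      by (rule cdf_diff_bound[OF m])
    finally have "\<bar>cdf_diff m k\<bar> / (p * (real n - real k) * level k) \<le> 32 / 3 / sqrt variance"
      using W v by (simp add: field_simps)
    moreover have "\<bar>stein_solution m k\<bar> = \<bar>cdf_diff m k\<bar> / (p * (real n - real k) * level k)"
      using W unfolding stein_solution_def by (simp only: abs_divide abs_of_pos)
    ultimately show ?thesis by simp
  qed
  have "expect (mu n p) f - expect (nu n m) f
      = mean (\<lambda>x. of_bool (f x)) - (1 / level m) * mean (\<lambda>x. of_bool (f x) * of_bool (weight n x = m))"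
    by (simp add: expect_nu_eq[OF mn]) (simp add: expect_def expectation_eq_mean)
  also have "\<dots> = mean (\<lambda>x. of_bool (f x) * (1 - of_bool (weight n x = m) / level m))"
    unfolding mean_cmult[symmetric] mean_diff[symmetric]
    by (intro mean_cong) (simp add: algebra_simps)
  also have "\<dots> = mean (\<lambda>x. of_bool (f x) *
      (p * (real n - real (weight n x)) * stein_solution m (weight n x)
        - (1 - p) * real (weight n x) * stein_solution m (weight n x - 1)))"
    by (simp only: stein_equation[OF weight_le mn])
  also have "\<dots> = up_edge_sum (\<lambda>i x. stein_solution m (weight n x) *
      (of_bool (f x) - of_bool (f (flip i x))))"
    by (rule integration_by_parts[symmetric])
  finally show ?thesis
    using weighted_difference_le_influence[of "stein_solution m", OF bound] by simp
qed

end

text \<open>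
  The bound \<open>expect_mu_nu_bound\<close> applies as soon as \<open>p(1-p)n \<ge> 1\<close>, and its right-hand side tends to
  zero by the assumption on the influences.
\<close>

theorem theorem8p4:
  fixes n :: "nat \<Rightarrow> nat"
    and p :: "nat \<Rightarrow> real"
    and f :: "nat \<Rightarrow> (nat \<Rightarrow> bool) \<Rightarrow> bool"
  assumes "\<And>j. 0 < p j \<and> p j < 1"
    and "\<And>j. p j * real (n j) \<in> \<int>"
    and "filterlim (\<lambda>j. p j * (1 - p j) * real (n j)) at_top sequentially"
    and "(\<lambda>j. total_influence (n j) (p j) (f j))
           \<in> o[sequentially](\<lambda>j. sqrt (p j * (1 - p j) * real (n j)))"
  shows "(\<lambda>j. \<bar>expect (mu (n j) (p j)) (f j)
               - expect (nu (n j) (nat \<lfloor>p j * real (n j)\<rfloor>)) (f j)\<bar>)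
           \<in> o[sequentially](\<lambda>_. 1)"
proof -
  let ?v = "\<lambda>j. p j * (1 - p j) * real (n j)"
  let ?r = "\<lambda>j. total_influence (n j) (p j) (f j) / sqrt (?v j)"
  have large: "eventually (\<lambda>j. 1 \<le> ?v j) sequentially"
    using assms(3) by (simp add: filterlim_at_top)
  from assms(4) have "(?r \<longlongrightarrow> 0) sequentially"
    by (rule smalloD_tendsto)
  then have lim: "((\<lambda>j. 32 / 3 * ?r j) \<longlongrightarrow> 0) sequentially"
    by (rule tendsto_mult_right_zero)
  have bound: "eventually (\<lambda>j. \<bar>expect (mu (n j) (p j)) (f j)
               - expect (nu (n j) (nat \<lfloor>p j * real (n j)\<rfloor>)) (f j)\<bar> \<le> 32 / 3 * ?r j) sequentially"
    using large
  proof eventually_elim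
    case (elim j)
    interpret biased_cube "n j" "p j"
      using assms(1)[of j] by unfold_locales auto
    have "real (nat \<lfloor>p j * real (n j)\<rfloor>) = p j * real (n j)"
    proof -
      obtain z where z: "p j * real (n j) = of_int z"
        using assms(2)[of j] by (auto elim: Ints_cases)
      have "0 \<le> p j * real (n j)" using p_pos by simp
      then show ?thesis by (simp add: z)
    qed
    then show ?case
      using expect_mu_nu_bound[of _ "f j"] elim by (simp add: variance_def)
  qed
  show ?thesis
    by (rule smalloI_tendsto)
       (use bound in \<open>auto intro: tendsto_sandwich[OF _ bound tendsto_const lim]\<close>)
qed

end
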